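(* Fix $x \in \mathcal{X} \setminus \mathcal{X}_\star$ and a radius $t$ with $0 < t \le t(x)$, and let $x_{\rm lmo} \in \operatorname{argmin}_{z \in \mathcal{X} \cap \mathcal{B}(x,t)} \langle \nabla f(x), z\rangle$. Put $$s_{\rm lmo}(x,t) := \left\langle \frac{\nabla f(x)}{\|\nabla f(x)\|},\, x - x_{\rm lmo}\right\rangle .$$ Then: 1. $0 < s_{\rm lmo}(x,t) \le t \le t(x) \le s_\star(x)$, so the half-space $\mathcal{H}_x(\nabla f(x), s_{\rm lmo}(x,t))$ separates $x$ from, and localizes, the set of minimizers: $x \notin \mathcal{H}_x(\nabla f(x), s_{\rm lmo}(x,t))$ and $\mathcal{X}_\star \subseteq \mathcal{H}_x(\nabla f(x), s_{\rm lmo}(x,t))$. 2. $x_{\rm lmo} = \mathrm{Proj}_{\mathcal{X} \cap \mathcal{H}_x(\nabla f(x),\, s_{\rm lmo}(x,t))}(x)$. In particular, $\operatorname{argmin}_{z \in \mathcal{X} \cap \mathcal{B}(x,t)} \langle \nabla f(x), z\rangle$ is a singleton. 3. $\|x_{\rm lmo} - x\| = \operatorname{dist}\bigl(x,\, \mathcal{X} \cap \mathcal{H}_x(\nabla f(x), s_{\rm lmo}(x,t))\bigr) = t$. 4. $\|x_{\rm lmo} - x_\star\|^2 \le \|x - x_\star\|^2 - t^2$ for all $x_\star \in \mathcal{X}_\star$.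
   Context: Standing assumption: $\mathcal{X} \subseteq \mathbb{R}^d$ is non-empty, closed and convex; $f:\mathbb{R}^d\to\mathbb{R}$ is convex and differentiable; the solution set $\mathcal{X}_\star := \operatorname{argmin}_{z\in\mathcal{X}} f(z)$ is non-empty. Write $f_\star := \min_{z\in\mathcal{X}} f(z)$. Norms and inner products are Euclidean. For $x\in\mathcal{X}\setminus\mathcal{X}_\star$ one has $\nabla f(x)\neq 0$. $\mathcal{B}(x,t) := \{z\in\mathbb{R}^d : \|z-x\|\le t\}$. $\mathrm{Proj}_{\mathcal{C}}$ is the Euclidean projection onto a non-empty closed convex set $\mathcal{C}$, and $\operatorname{dist}(x,\mathcal{C})$ the Euclidean distance. For $x\in\mathcal{X}\setminus\mathcal{X}_\star$, the Polyak radius is $t(x) := \frac{f(x)-f_\star}{\|\nabla f(x)\|}$, and $s_\star(x) := \inf_{x_\star\in\mathcal{X}_\star}\left\langle \frac{\nabla f(x)}{\|\nabla f(x)\|}, x-x_\star\right\rangle$. For $x\in\mathbb{R}^d$, $g\in\mathbb{R}^d\setminus\{0\}$ and $s\ge 0$, $\mathcal{H}_x(g,s) := \left\{z\in\mathbb{R}^d : \left\langle \frac{g}{\|g\|}, x-z\right\rangle \ge s\right\}$. *)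

theory Defs
  imports "HOL-Analysis.Analysis"
begin

definition argmin_set :: "('a \<Rightarrow> real) \<Rightarrow> 'a set \<Rightarrow> 'a set" where
  "argmin_set f S = {z. is_arg_min f (\<lambda>y. y \<in> S) z}"

lemma mem_argmin_set: "z \<in> argmin_set f S \<longleftrightarrow> z \<in> S \<and> (\<forall>y\<in>S. f z \<le> f y)"
  by (auto simp: argmin_set_def is_arg_min_def not_less)

text \<open>The minimum, under the proviso that it is attained.\<close>
definition min_value :: "('a \<Rightarrow> real) \<Rightarrow> 'a set \<Rightarrow> real" where
  "min_value f S = (LEAST v. v \<in> f ` S)"

lemma min_value_eq: "z \<in> argmin_set f S \<Longrightarrow> min_value f S = f z"
  unfolding min_value_def by (rule Least_equality) (auto simp: mem_argmin_set)

definition grad :: "('a::real_inner \<Rightarrow> real) \<Rightarrow> 'a \<Rightarrow> 'a" where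
  "grad f x = (THE D. GDERIV f x :> D)"

lemma GDERIV_grad:
  fixes f :: "'a::euclidean_space \<Rightarrow> real"
  assumes "f differentiable (at x)"
  shows "GDERIV f x :> grad f x"
proof -
  from assms obtain f' where f': "(f has_derivative f') (at x)"
    unfolding differentiable_def by blast
  define D where "D = adjoint f' 1"
  have "h \<bullet> D = f' h" for h
    using adjoint_works[OF has_derivative_linear[OF f'], of h 1]
    by (simp add: D_def inner_commute)
  hence D: "GDERIV f x :> D"
    using f' by (simp add: gderiv_def)
  have "E = D" if "GDERIV f x :> E" for E
  proof -
    have "(\<lambda>h. h \<bullet> E) = (\<lambda>h. h \<bullet> D)"
      using that D unfolding gderiv_def by (rule has_derivative_unique)
    hence "\<forall>h. h \<bullet> E = h \<bullet> D"
      by (simp add: fun_eq_iff)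
    thus ?thesis by (simp only: vector_eq_ldot)
  qed
  from D this show ?thesis unfolding grad_def by (rule theI)
qed

definition polyak_radius :: "('a::real_inner \<Rightarrow> real) \<Rightarrow> 'a set \<Rightarrow> 'a \<Rightarrow> real" where
  "polyak_radius f X x = (f x - min_value f X) / norm (grad f x)"

definition s_star :: "('a::real_inner \<Rightarrow> real) \<Rightarrow> 'a set \<Rightarrow> 'a \<Rightarrow> real" where
  "s_star f X x = (INF x_star\<in>argmin_set f X. (grad f x /\<^sub>R norm (grad f x)) \<bullet> (x - x_star))"

definition halfspace :: "'a::real_inner \<Rightarrow> 'a \<Rightarrow> real \<Rightarrow> 'a set" where
  "halfspace x g s = {z. (g /\<^sub>R norm g) \<bullet> (x - z) \<ge> s}"

text \<open>The radius \<open>t\<close> enters only through the chosen minimizer \<open>x_lmo\<close> of the linear subproblem.\<close>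
definition s_lmo :: "('a::real_inner \<Rightarrow> real) \<Rightarrow> 'a \<Rightarrow> 'a \<Rightarrow> real" where
  "s_lmo f x x_lmo = (grad f x /\<^sub>R norm (grad f x)) \<bullet> (x - x_lmo)"

end

theory Submission
  imports Defs
begin

text \<open>Every minimizer satisfies \<open>g \<bullet> (x - x\<^sub>\<star>) \<ge> f x - f\<^sub>\<star> \<ge> t \<parallel>g\<parallel>\<close>, by the
  gradient inequality. A feasible point at distance less than \<open>t\<close> from \<open>x\<close> decreases the linear
  objective by less than \<open>t \<parallel>g\<parallel>\<close>, so moving it towards a minimizer, up to the boundary of the ball,
  strictly improves it. Hence no feasible point that is at least as good as \<open>x_lmo\<close> lies closer to
  \<open>x\<close> than \<open>t\<close>: \<open>x_lmo\<close> is the projection of \<open>x\<close> onto the cut, and the rest is the obtuse angle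
  property of projections.\<close>

text \<open>Restricting \<open>f\<close> to the line through \<open>x\<close> and \<open>y\<close>
  gives a convex function \<open>h\<close> of one real variable with slope
  \<open>D \<bullet> (y - x)\<close> at 0. The claim is its tangent inequality between 0 and
  1.\<close>

lemma convex_on_gradient_inequality:
  fixes f :: "'a::real_inner \<Rightarrow> real"
  assumes "convex_on UNIV f" and "GDERIV f x :> D"
  shows "f x + D \<bullet> (y - x) \<le> f y"
proof -
  define h where "h = (\<lambda>r::real. f (x + r *\<^sub>R (y - x)))"
  have "convex_on UNIV h"
  proof (rule convex_onI)
    fix r a b :: real
    assume "0 < r" "r < 1"
    have "x + ((1 - r) *\<^sub>R a + r *\<^sub>R b) *\<^sub>R (y - x)
        = (1 - r) *\<^sub>R (x + a *\<^sub>R (y - x)) + r *\<^sub>R (x + b *\<^sub>R (y - x))"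
      by (simp add: algebra_simps)
    then show "h ((1 - r) *\<^sub>R a + r *\<^sub>R b) \<le> (1 - r) * h a + r * h b"
      unfolding h_def
      using convex_onD[OF assms(1), of r "x + a *\<^sub>R (y - x)" "x + b *\<^sub>R (y - x)"]
        \<open>0 < r\<close> \<open>r < 1\<close> by simp
  qed simp
  moreover have "(h has_real_derivative D \<bullet> (y - x)) (at 0)"
  proof -
    have "(f has_derivative (\<lambda>v. v \<bullet> D)) (at (x + 0 *\<^sub>R (y - x)))"
      using assms(2) by (simp add: gderiv_def)
    moreover have "((\<lambda>r::real. x + r *\<^sub>R (y - x)) has_derivative (\<lambda>r. r *\<^sub>R (y - x))) (at 0)"
      by (auto intro!: derivative_eq_intros)
    ultimately have "(h has_derivative (\<lambda>r. (r *\<^sub>R (y - x)) \<bullet> D)) (at 0)"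
      unfolding h_def by (rule has_derivative_compose[rotated])
    then show ?thesis
      by (simp add: has_field_derivative_def inner_commute mult_commute_abs)
  qed
  ultimately have "h 1 - h 0 \<ge> (D \<bullet> (y - x)) * (1 - 0)"
    by (intro convex_on_imp_above_tangent[where A = UNIV]) auto
  then show ?thesis by (simp add: h_def)
qed

lemma closed_halfspace: "closed (halfspace x g s)"
  unfolding halfspace_def by (intro closed_Collect_le continuous_intros)

lemma convex_halfspace: "convex (halfspace x g s)"
proof -
  have "halfspace x g s = {z. (g /\<^sub>R norm g) \<bullet> z \<le> (g /\<^sub>R norm g) \<bullet> x - s}"
    unfolding halfspace_def by (auto simp: inner_diff_right)
  then show ?thesis by (simp only: convex_halfspace_le)
qed

lemma argmin_set_nonempty:
  assumes "compact S" "S \<noteq> {}" "continuous_on S f"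
  shows "argmin_set f S \<noteq> {}"
  using continuous_attains_inf[OF assms] unfolding ex_in_conv[symmetric] mem_argmin_set by blast

text \<open>The angle at the projection \<open>p\<close> between \<open>x\<close> and
  \<open>z\<close> is not acute, so the cross term in the expansion of
  \<open>(x - p) - (z - p)\<close> has a favourable sign.\<close>

lemma closest_point_pythagoras:
  assumes "closed S" "convex S" "z \<in> S"
  shows "(norm (closest_point S x - z))\<^sup>2 \<le> (norm (x - z))\<^sup>2 - (norm (closest_point S x - x))\<^sup>2"
proof -
  define p where "p = closest_point S x"
  have "(x - p) \<bullet> (z - p) \<le> 0"
    unfolding p_def by (rule closest_point_dot[OF assms(2,1,3)])
  moreover have "(norm (x - z))\<^sup>2 = (norm (p - x))\<^sup>2 + (norm (p - z))\<^sup>2 - 2 * ((x - p) \<bullet> (z - p))"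
    by (simp add: power2_norm_eq_inner inner_diff inner_commute)
  ultimately show ?thesis by (simp add: p_def)
qed

text \<open>The subproblem in normalized form: \<open>u\<close> is the unit gradient direction,
  \<open>p\<close> a minimizer over the ball, and \<open>y\<close> a solution of the original
  problem, known only through its depth of at least \<open>t\<close> along \<open>u\<close>. The
  last conclusion is the core; taking \<open>z\<close> to be \<open>x\<close> in it gives
  positivity.\<close>

lemma linear_minimizer_in_ball:
  fixes x y p :: "'a::euclidean_space"
  assumes "convex X" "x \<in> X" "y \<in> X" and "norm u = 1" and "0 < t" and y: "t \<le> u \<bullet> (x - y)"
    and p: "p \<in> X" "norm (p - x) \<le> t" "\<And>z. z \<in> X \<Longrightarrow> norm (z - x) \<le> t \<Longrightarrow> u \<bullet> p \<le> u \<bullet> z"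
  shows "0 < u \<bullet> (x - p)" and "u \<bullet> (x - p) \<le> t"
    and "\<And>z. z \<in> X \<Longrightarrow> u \<bullet> (x - p) \<le> u \<bullet> (x - z) \<Longrightarrow> t \<le> norm (z - x)"
proof -
  have upper: "u \<bullet> (x - z) \<le> norm (z - x)" for z
    using norm_cauchy_schwarz[of u "x - z"] \<open>norm u = 1\<close> by (simp add: norm_minus_commute)
  show "u \<bullet> (x - p) \<le> t" using upper[of p] p(2) by simp
  have far: "t \<le> norm (z - x)" if z: "z \<in> X" "u \<bullet> (x - p) \<le> u \<bullet> (x - z)" for z
  proof (rule ccontr)
    define a b where "a = norm (z - x)" and "b = norm (y - x)"
    \<comment> \<open>This weight solves \<open>(1 - r) * a + r * b = t\<close>, so the triangle
      inequality keeps \<open>w\<close> inside the ball.\<close>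
    define r where "r = (t - a) / (b - a)"
    define w where "w = (1 - r) *\<^sub>R z + r *\<^sub>R y"
    assume "\<not> t \<le> norm (z - x)"
    then have "a < t" by (simp add: a_def)
    have "t \<le> b" using upper[of y] y by (simp add: b_def)
    have r: "0 < r" "r \<le> 1" using \<open>a < t\<close> \<open>t \<le> b\<close> by (auto simp: r_def field_simps)
    have "w \<in> X"
      unfolding w_def using \<open>convex X\<close> z(1) \<open>y \<in> X\<close> r by (intro convexD) auto
    have "w - x = (1 - r) *\<^sub>R (z - x) + r *\<^sub>R (y - x)"
      by (simp add: w_def algebra_simps)
    then have "norm (w - x) \<le> (1 - r) * a + r * b"
      using norm_triangle_ineq[of "(1 - r) *\<^sub>R (z - x)" "r *\<^sub>R (y - x)"] r
      by (simp add: a_def b_def)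
    also have "\<dots> = a + r * (b - a)" by (simp add: algebra_simps)
    also have "\<dots> = t" using \<open>a < t\<close> \<open>t \<le> b\<close> by (simp add: r_def)
    finally have "u \<bullet> p \<le> u \<bullet> w" using p(3) \<open>w \<in> X\<close> by blast
    moreover have "u \<bullet> w = u \<bullet> z - r * (u \<bullet> (x - y) - u \<bullet> (x - z))"
      by (simp add: w_def inner_diff_right inner_add_right algebra_simps)
    \<comment> \<open>By Cauchy-Schwarz the depth of \<open>z\<close> is at most \<open>a\<close>,
      and \<open>a < t\<close>, whereas \<open>y\<close> has depth at least \<open>t\<close>. Hence
      \<open>w\<close> strictly improves on \<open>z\<close>, which is at least as good as
      \<open>p\<close>.\<close>
    moreover have "0 < r * (u \<bullet> (x - y) - u \<bullet> (x - z))"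
      using r upper[of z] \<open>a < t\<close> y by (simp add: a_def)
    ultimately show False using z(2) by (simp add: inner_diff_right)
  qed
  then show "\<And>z. z \<in> X \<Longrightarrow> u \<bullet> (x - p) \<le> u \<bullet> (x - z) \<Longrightarrow> t \<le> norm (z - x)" .
  \<comment> \<open>Otherwise \<open>x\<close> itself would be at least as good as \<open>p\<close>,
    and \<open>far\<close> would bound its zero distance to itself below by
    \<open>t\<close>.\<close>
  show "0 < u \<bullet> (x - p)"
    using far[OF \<open>x \<in> X\<close>] \<open>0 < t\<close> by force
qed

theorem theorem2:
  fixes f :: "real ^ 'd \<Rightarrow> real" and X :: "(real ^ 'd) set"
    and x :: "real ^ 'd" and t :: real
  assumes "X \<noteq> {}" and "closed X" and "convex X"
    and "convex_on UNIV f" and "f differentiable_on UNIV"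
    and "argmin_set f X \<noteq> {}"
    and "x \<in> X - argmin_set f X"
    and "0 < t" and "t \<le> polyak_radius f X x"
  shows "is_singleton (argmin_set (\<lambda>z. grad f x \<bullet> z) (X \<inter> cball x t)) \<and>
    (\<forall>x_lmo \<in> argmin_set (\<lambda>z. grad f x \<bullet> z) (X \<inter> cball x t).
      let s = s_lmo f x x_lmo; H = halfspace x (grad f x) s in
        (0 < s \<and> s \<le> t \<and> t \<le> polyak_radius f X x \<and> polyak_radius f X x \<le> s_star f X x \<and>
          x \<notin> H \<and> argmin_set f X \<subseteq> H) \<and>
        x_lmo = closest_point (X \<inter> H) x \<and>
        (norm (x_lmo - x) = infdist x (X \<inter> H) \<and> infdist x (X \<inter> H) = t) \<and>
        (\<forall>x_star \<in> argmin_set f X.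
          (norm (x_lmo - x_star))\<^sup>2 \<le> (norm (x - x_star))\<^sup>2 - t\<^sup>2))"
proof -
  define g where "g = grad f x"
  define u where "u = g /\<^sub>R norm g"
  define A where "A = argmin_set (\<lambda>z. g \<bullet> z) (X \<inter> cball x t)"
  define H where "H = (\<lambda>p. halfspace x g (u \<bullet> (x - p)))"
  have "x \<in> X" and "x \<notin> argmin_set f X" using assms(7) by auto
  have "GDERIV f x :> g"
    unfolding g_def using assms(5) by (intro GDERIV_grad) (simp add: differentiable_on_def)
  note gradient = convex_on_gradient_inequality[OF assms(4) this]
  have gap: "0 < f x - min_value f X \<and> f x - min_value f X \<le> g \<bullet> (x - y)"
    if "y \<in> argmin_set f X" for y
  proof -
    \<comment> \<open>Equality would make \<open>x\<close> a minimizer. The strict gap also forces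
      the gradient to be nonzero below.\<close>
    have "f y \<noteq> f x"
      using that \<open>x \<in> X\<close> \<open>x \<notin> argmin_set f X\<close> by (auto simp: mem_argmin_set)
    moreover have "f y \<le> f x" using that \<open>x \<in> X\<close> by (auto simp: mem_argmin_set)
    ultimately show ?thesis
      using gradient[of y] by (simp add: min_value_eq[OF that] inner_diff_right)
  qed
  obtain y where y: "y \<in> argmin_set f X" using assms(6) by blast
  have "g \<noteq> 0" using gap[OF y] by auto
  then have "norm u = 1" by (simp add: u_def)
  have radius: "polyak_radius f X x \<le> u \<bullet> (x - z)" if "z \<in> argmin_set f X" for z
    using gap[OF that] divide_right_mono[of "f x - min_value f X" "g \<bullet> (x - z)" "norm g"]
    by (simp add: polyak_radius_def u_def g_def[symmetric] divide_inverse mult.commute)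
  have star: "polyak_radius f X x \<le> s_star f X x"
    unfolding s_star_def g_def[symmetric] u_def[symmetric]
    using assms(6) radius by (rule cINF_greatest)
  \<comment> \<open>Dividing the objective by \<open>norm g > 0\<close> does not change its
    minimizers, so \<open>u\<close> may replace \<open>g\<close>.\<close>
  have mem_A: "p \<in> A \<longleftrightarrow> p \<in> X \<and> norm (p - x) \<le> t \<and>
      (\<forall>z\<in>X. norm (z - x) \<le> t \<longrightarrow> u \<bullet> p \<le> u \<bullet> z)" for p
    using \<open>g \<noteq> 0\<close> by (auto simp: A_def u_def mem_argmin_set dist_norm norm_minus_commute)
  have mem_H: "z \<in> H p \<longleftrightarrow> u \<bullet> (x - p) \<le> u \<bullet> (x - z)" for z p
    by (simp add: H_def halfspace_def u_def)
  have cut: "closed (X \<inter> H p)" "convex (X \<inter> H p)" for p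
    using assms(2,3)
    by (auto simp: H_def closed_halfspace convex_halfspace intro: closed_Int convex_Int)
  have main: "0 < u \<bullet> (x - p)" "u \<bullet> (x - p) \<le> t" "p \<in> X \<inter> H p" "norm (p - x) = t"
      "p = closest_point (X \<inter> H p) x" "infdist x (X \<inter> H p) = t" if "p \<in> A" for p
  proof -
    have p: "p \<in> X" "norm (p - x) \<le> t"
      and "\<And>z. z \<in> X \<Longrightarrow> norm (z - x) \<le> t \<Longrightarrow> u \<bullet> p \<le> u \<bullet> z"
      using that by (auto simp: mem_A)
    moreover have "y \<in> X" "t \<le> u \<bullet> (x - y)"
      using y radius[OF y] assms(9) by (auto simp: mem_argmin_set)
    ultimately have *: "0 < u \<bullet> (x - p)" "u \<bullet> (x - p) \<le> t"
        "\<And>z. z \<in> X \<Longrightarrow> u \<bullet> (x - p) \<le> u \<bullet> (x - z) \<Longrightarrow> t \<le> norm (z - x)"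
      using linear_minimizer_in_ball[OF assms(3) \<open>x \<in> X\<close> _ \<open>norm u = 1\<close> assms(8)] by blast+
    show "0 < u \<bullet> (x - p)" "u \<bullet> (x - p) \<le> t" by fact+
    show mem: "p \<in> X \<inter> H p" using p by (simp add: mem_H)
    show eq: "norm (p - x) = t" using *(3)[of p] p by simp
    \<comment> \<open>Points of the cut are at least as good as \<open>p\<close>, hence at distance
      at least \<open>t\<close>, and \<open>p\<close> attains this bound.\<close>
    have "dist x p \<le> dist x z" if "z \<in> X \<inter> H p" for z
      using that *(3)[of z] eq by (simp add: mem_H dist_norm norm_minus_commute)
    then show cp: "p = closest_point (X \<inter> H p) x"
      using cut mem by (intro closest_point_unique) auto
    show "infdist x (X \<inter> H p) = t"
      using setdist_closest_point[OF cut(1), of p x] mem eq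
      unfolding cp[symmetric] infdist_eq_setdist by (auto simp: dist_norm norm_minus_commute)
  qed
  have "A \<noteq> {}"
    unfolding A_def using assms(2,8) \<open>x \<in> X\<close>
    by (intro argmin_set_nonempty closed_Int_compact continuous_intros) auto
  moreover have "p = q" if "p \<in> A" "q \<in> A" for p q
  proof -
    \<comment> \<open>Two minimizers share the optimal value, hence the same half-space, and both
      are the projection of \<open>x\<close> onto the same cut.\<close>
    have "u \<bullet> p = u \<bullet> q" using that by (meson mem_A order.antisym)
    then have "H p = H q" by (simp add: H_def inner_diff_right)
    then show ?thesis using main(5) that by metis
  qed
  ultimately have "is_singleton A" by (metis is_singletonI')
  moreover have "(0 < u \<bullet> (x - p) \<and> u \<bullet> (x - p) \<le> t \<and> t \<le> polyak_radius f X x \<and>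
        polyak_radius f X x \<le> s_star f X x \<and> x \<notin> H p \<and> argmin_set f X \<subseteq> H p) \<and>
      p = closest_point (X \<inter> H p) x \<and>
      (norm (p - x) = infdist x (X \<inter> H p) \<and> infdist x (X \<inter> H p) = t) \<and>
      (\<forall>z \<in> argmin_set f X. (norm (p - z))\<^sup>2 \<le> (norm (x - z))\<^sup>2 - t\<^sup>2)" if "p \<in> A" for p
  proof -
    note m = main[OF that]
    \<comment> \<open>The depth of \<open>p\<close> is at most \<open>t\<close>, which is at most
      the Polyak radius and so at most the depth of any solution. Solutions thus lie in the cut,
      where the Pythagorean estimate applies.\<close>
    have sub: "argmin_set f X \<subseteq> X \<inter> H p"
      using radius m(2) assms(9) by (fastforce simp: mem_H mem_argmin_set)
    moreover have "(norm (p - z))\<^sup>2 \<le> (norm (x - z))\<^sup>2 - t\<^sup>2" if "z \<in> argmin_set f X" for z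
      using closest_point_pythagoras[OF cut, of z p x] sub that m(4) m(5)[symmetric] by auto
    moreover have "x \<notin> H p" using m(1) by (simp add: mem_H)
    moreover have "norm (p - x) = infdist x (X \<inter> H p)" using m(4,6) by simp
    ultimately show ?thesis using m(1,2,5,6) star assms(9) by blast
  qed
  ultimately show ?thesis
    unfolding A_def H_def u_def g_def Let_def s_lmo_def by blast
qed

end
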